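(* Let $\mathcal{X},\mathcal{Y}$ be finite alphabets, $\{P_\theta(y|x),\ x\in\mathcal{X},\ y\in\mathcal{Y},\ \theta\in\Theta\}$ a family of discrete memoryless channels, $R\ge 0$, $T\ge 0$, $\xi\in(0,1]$, $n\ge 1$ and $M=e^{nR}$ (an integer). With $E_1(R,T,\theta)$, $\Gamma_\theta(\mathcal{C},\mathcal{R})$, $K_n(\mathcal{C},\mathcal{R})$, $K_n(\mathcal{C})$ and the decoder $\hat{\mathcal{R}}$ defined in the context, for every code $\mathcal{C}=\{\boldsymbol{x}_1,\ldots,\boldsymbol{x}_M\}\subset\mathcal{X}^n$, $$K_n(\mathcal{C},\hat{\mathcal{R}})\le (n+1)^{|\mathcal{X}|\cdot|\mathcal{Y}|-1}\,K_n(\mathcal{C}).$$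
   Context: Channels: for each $\theta$ in a nonempty set $\Theta$, $P_\theta(\cdot|x)$ is a probability distribution on $\mathcal{Y}$ for every $x\in\mathcal{X}$, and for $\boldsymbol{x}\in\mathcal{X}^n$, $\boldsymbol{y}\in\mathcal{Y}^n$, $P_\theta(\boldsymbol{y}|\boldsymbol{x})=\prod_{i=1}^n P_\theta(y_i|x_i)$. Codes and erasure decoders: a rate-$R$ code of length $n$ is $\mathcal{C}=\{\boldsymbol{x}_1,\ldots,\boldsymbol{x}_M\}$, $\boldsymbol{x}_m\in\mathcal{X}^n$, $M=e^{nR}$, with equiprobable messages. A decoder with an erasure option is a partition $\mathcal{R}=(\mathcal{R}_0,\mathcal{R}_1,\ldots,\mathcal{R}_M)$ of $\mathcal{Y}^n$: decide message $m$ if $\boldsymbol{y}\in\mathcal{R}_m$, $m\ge1$, and declare an erasure if $\boldsymbol{y}\in\mathcal{R}_0$. Under channel $\theta$, the probability of not making the right decision, and the probability of undetected error, are $$\Pr_\theta\{\mathcal{E}_1\}=\frac1M\sum_{m=1}^M\sum_{\boldsymbol{y}\in\mathcal{R}_m^c}P_\theta(\boldsymbol{y}|\boldsymbol{x}_m),\qquad \Pr_\theta\{\mathcal{E}_2\}=\frac1M\sum_{m=1}^M\sum_{\boldsymbol{y}\in\mathcal{R}_m}\sum_{m'\ne m}P_\theta(\boldsymbol{y}|\boldsymbol{x}_{m'}).$$ The Lagrangian is $\Gamma_\theta(\mathcal{C},\mathcal{R})=\Pr_\theta\{\mathcal{E}_2\}+e^{-nT}\Pr_\theta\{\mathcal{E}_1\}$.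 Forney's exponent for channel $\theta$: $$E_1(R,T,\theta)=\max_{0\le s\le\rho\le1}\max_Q\,[E_0(s,\rho,Q,\theta)-\rho R-sT],$$ $$E_0(s,\rho,Q,\theta)=-\ln\left[\sum_{y\in\mathcal{Y}}\Big(\sum_{x\in\mathcal{X}}Q(x)P_\theta^{1-s}(y|x)\Big)\Big(\sum_{x'\in\mathcal{X}}Q(x')P_\theta^{s/\rho}(y|x')\Big)^{\rho}\right],$$ where $Q$ ranges over probability distributions on $\mathcal{X}$, and at $s=\rho=0$ the last factor is taken to be $1$. Competitive minimax quantities, for the given $\xi$: $$K_n(\mathcal{C},\mathcal{R})=\max_{\theta\in\Theta}\frac{\Gamma_\theta(\mathcal{C},\mathcal{R})}{e^{-n[\xi E_1(R,T,\theta)+T]}},\qquad K_n(\mathcal{C})=\min_{\mathcal{R}}K_n(\mathcal{C},\mathcal{R}),$$ the minimum being over all decoders with an erasure option. Proposed universal decoder $\hat{\mathcal{R}}$: with $$f(\boldsymbol{x},\boldsymbol{y})=\max_{\theta\in\Theta}\left\{e^{n[\xi E_1(R,T,\theta)+T]}P_\theta(\boldsymbol{y}|\boldsymbol{x})\right\},$$ set, for $m=1,\ldots,M$, $$\hat{\mathcal{R}}_m=\Big\{\boldsymbol{y}:\ f(\boldsymbol{x}_m,\boldsymbol{y})\ge e^{nT}\sum_{m'\ne m}f(\boldsymbol{x}_{m'},\boldsymbol{y})\Big\},\qquad \hat{\mathcal{R}}_0=\bigcap_{m=1}^M\hat{\mathcal{R}}_m^c.$$ The formulas for $\Pr_\theta\{\mathcal{E}_1\},\Pr_\theta\{\mathcal{E}_2\},\Gamma_\theta,K_n$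 are applied to $\hat{\mathcal{R}}$ with these regions as they stand (even if ties make some of them overlap). Maxima over $\Theta$ are read as suprema if not attained. *)

theory Defs
  imports "HOL-Probability.Probability"
begin

type_synonym ('x, 'y) channel = "'x \<Rightarrow> 'y pmf"

definition words :: "nat \<Rightarrow> 'a list set" where
  "words n = {w. length w = n}"

definition word_prob :: "('x, 'y) channel \<Rightarrow> 'y list \<Rightarrow> 'x list \<Rightarrow> real" where
  "word_prob W ys xs = (\<Prod>i<length xs. pmf (W (xs ! i)) (ys ! i))"

text \<open>
  Messages are \<open>{1..M}\<close>, and the codeword of message \<open>m\<close> is \<open>C m\<close>.
  A code is an indexed family, so repeated codewords are allowed.
\<close>

definition is_code :: "nat \<Rightarrow> nat \<Rightarrow> (nat \<Rightarrow> 'x list) \<Rightarrow> bool" where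
  "is_code n M C \<longleftrightarrow> (\<forall>m\<in>{1..M}. C m \<in> words n)"

text \<open>
  The regions of a decoder partition the output words, but individual regions may be empty.
  Decoders are extensional on \<open>{0..M}\<close>, so that there are only finitely many of them.
\<close>

definition decoders :: "nat \<Rightarrow> nat \<Rightarrow> (nat \<Rightarrow> 'y list set) set" where
  "decoders n M =
     {D \<in> {0..M} \<rightarrow>\<^sub>E Pow (words n).
        (\<Union>m\<in>{0..M}. D m) = words n \<and> disjoint_family_on D {0..M}}"

definition prob_E1 ::
  "nat \<Rightarrow> nat \<Rightarrow> (nat \<Rightarrow> 'x list) \<Rightarrow> (nat \<Rightarrow> 'y list set) \<Rightarrow> ('x, 'y) channel \<Rightarrow> real" where
  "prob_E1 n M C D W =
     1 / real M * (\<Sum>m=1..M. \<Sum>y\<in>words n - D m. word_prob W y (C m))"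

definition prob_E2 ::
  "nat \<Rightarrow> (nat \<Rightarrow> 'x list) \<Rightarrow> (nat \<Rightarrow> 'y list set) \<Rightarrow> ('x, 'y) channel \<Rightarrow> real" where
  "prob_E2 M C D W =
     1 / real M * (\<Sum>m=1..M. \<Sum>y\<in>D m. \<Sum>m'\<in>{1..M} - {m}. word_prob W y (C m'))"

definition Lagrangian ::
  "nat \<Rightarrow> real \<Rightarrow> nat \<Rightarrow> (nat \<Rightarrow> 'x list) \<Rightarrow> (nat \<Rightarrow> 'y list set) \<Rightarrow> ('x, 'y) channel \<Rightarrow> real" where
  "Lagrangian n T M C D W = prob_E2 M C D W + exp (- real n * T) * prob_E1 n M C D W"

text \<open>Real power with \<open>x\<^sup>0 = 1\<close> also for \<open>x = 0\<close>, whereas \<open>0 powr 0 = 0\<close>.\<close>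

definition rpow :: "real \<Rightarrow> real \<Rightarrow> real" where
  "rpow x a = (if a = 0 then 1 else x powr a)"

text \<open>
  For \<open>0 \<le> s \<le> \<rho>\<close>, the case \<open>\<rho> = 0\<close> forces \<open>s = 0\<close>; the last factor is then
  \<open>rpow _ 0 = 1\<close>, whatever the value of \<open>s / \<rho>\<close>.
\<close>

definition E0 :: "real \<Rightarrow> real \<Rightarrow> 'x::finite pmf \<Rightarrow> ('x, 'y::finite) channel \<Rightarrow> real" where
  "E0 s \<rho> Q W =
     - ln (\<Sum>y\<in>UNIV. (\<Sum>x\<in>UNIV. pmf Q x * rpow (pmf (W x) y) (1 - s)) *
                     rpow (\<Sum>x'\<in>UNIV. pmf Q x' * rpow (pmf (W x') y) (s / \<rho>)) \<rho>)"

text \<open>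
  A supremum, because the objective can jump up on leaving the edges \<open>s = 0\<close> and \<open>s = 1\<close> when some
  transition probabilities vanish. Extending the objective continuously there, which makes
  the maximum attained, gives the same value.
\<close>

definition E1 :: "real \<Rightarrow> real \<Rightarrow> ('x::finite, 'y::finite) channel \<Rightarrow> real" where
  "E1 R T W =
     (SUP (s, \<rho>)\<in>{(s, \<rho>). 0 \<le> s \<and> s \<le> \<rho> \<and> \<rho> \<le> 1}.
        SUP Q\<in>UNIV. E0 s \<rho> Q W - \<rho> * R - s * T)"

definition K_dec ::
  "nat \<Rightarrow> real \<Rightarrow> real \<Rightarrow> real \<Rightarrow> nat \<Rightarrow> 't set \<Rightarrow> ('t \<Rightarrow> ('x::finite, 'y::finite) channel) \<Rightarrow>
   (nat \<Rightarrow> 'x list) \<Rightarrow> (nat \<Rightarrow> 'y list set) \<Rightarrow> real" where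
  "K_dec n R T \<xi> M \<Theta> P C D =
     (SUP \<theta>\<in>\<Theta>. Lagrangian n T M C D (P \<theta>) / exp (- real n * (\<xi> * E1 R T (P \<theta>) + T)))"

definition K_code ::
  "nat \<Rightarrow> real \<Rightarrow> real \<Rightarrow> real \<Rightarrow> nat \<Rightarrow> 't set \<Rightarrow> ('t \<Rightarrow> ('x::finite, 'y::finite) channel) \<Rightarrow>
   (nat \<Rightarrow> 'x list) \<Rightarrow> real" where
  "K_code n R T \<xi> M \<Theta> P C = Min (K_dec n R T \<xi> M \<Theta> P C ` decoders n M)"

definition metric_f ::
  "nat \<Rightarrow> real \<Rightarrow> real \<Rightarrow> real \<Rightarrow> 't set \<Rightarrow> ('t \<Rightarrow> ('x::finite, 'y::finite) channel) \<Rightarrow>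
   'x list \<Rightarrow> 'y list \<Rightarrow> real" where
  "metric_f n R T \<xi> \<Theta> P x y =
     (SUP \<theta>\<in>\<Theta>. exp (real n * (\<xi> * E1 R T (P \<theta>) + T)) * word_prob (P \<theta>) y x)"

definition univ_region ::
  "nat \<Rightarrow> real \<Rightarrow> real \<Rightarrow> real \<Rightarrow> nat \<Rightarrow> 't set \<Rightarrow> ('t \<Rightarrow> ('x::finite, 'y::finite) channel) \<Rightarrow>
   (nat \<Rightarrow> 'x list) \<Rightarrow> nat \<Rightarrow> 'y list set" where
  "univ_region n R T \<xi> M \<Theta> P C m =
     {y \<in> words n. metric_f n R T \<xi> \<Theta> P (C m) y \<ge>
        exp (real n * T) * (\<Sum>m'\<in>{1..M} - {m}. metric_f n R T \<xi> \<Theta> P (C m') y)}"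

text \<open>Ties may make the regions overlap, so this need not be an element of \<open>decoders n M\<close>.\<close>

definition univ_decoder ::
  "nat \<Rightarrow> real \<Rightarrow> real \<Rightarrow> real \<Rightarrow> nat \<Rightarrow> 't set \<Rightarrow> ('t \<Rightarrow> ('x::finite, 'y::finite) channel) \<Rightarrow>
   (nat \<Rightarrow> 'x list) \<Rightarrow> nat \<Rightarrow> 'y list set" where
  "univ_decoder n R T \<xi> M \<Theta> P C m =
     (if m = 0 then \<Inter>m'\<in>{1..M}. words n - univ_region n R T \<xi> M \<Theta> P C m'
      else univ_region n R T \<xi> M \<Theta> P C m)"

text \<open>
  The suprema above are taken over nonempty bounded sets of reals and the minimum over a
  nonempty finite set, so none of them takes an unspecified value.
\<close>

lemma finite_words: "finite (words n :: 'a::finite list set)"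
  using finite_lists_length_eq[of "UNIV :: 'a set" n] by (simp add: words_def)

lemma finite_decoders: "finite (decoders n M :: (nat \<Rightarrow> 'y::finite list set) set)"
proof -
  have "finite ({0..M} \<rightarrow>\<^sub>E Pow (words n :: 'y list set))"
    by (intro finite_PiE) (auto simp: finite_words)
  then show ?thesis
    unfolding decoders_def by (rule finite_subset[rotated]) auto
qed

lemma decoders_nonempty: "decoders n M \<noteq> {}"
proof -
  have "(\<lambda>m\<in>{0..M}. if m = 0 then words n else {}) \<in> decoders n M"
    by (auto simp: decoders_def disjoint_family_on_def split: if_splits)
  then show ?thesis by blast
qed

lemma word_prob_nonneg: "0 \<le> word_prob W y x"
  unfolding word_prob_def by (intro prod_nonneg) auto

lemma word_prob_le_1: "word_prob W y x \<le> 1"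
  unfolding word_prob_def by (intro prod_le_1) (auto simp: pmf_le_1)

lemma rpow_nonneg: "0 \<le> rpow x a"
  by (simp add: rpow_def)

lemma rpow_ge:
  assumes "0 \<le> x" "x \<le> 1" "0 \<le> a" "a \<le> 1"
  shows "x \<le> rpow x a"
proof (cases "x = 0 \<or> a = 0")
  case True
  then show ?thesis using assms by (auto simp: rpow_def)
next
  case False
  then have "x powr 1 \<le> x powr a" using assms by (intro powr_mono') auto
  then show ?thesis using False assms by (simp add: rpow_def)
qed

lemma rpow_mono:
  assumes "0 \<le> x" "x \<le> y" "0 \<le> a"
  shows "rpow x a \<le> rpow y a"
  using assms by (simp add: rpow_def powr_mono2)

lemma sum_pmf_UNIV: "(\<Sum>x\<in>UNIV. pmf (Q :: 'a::finite pmf) x) = 1"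
  by (rule sum_pmf_eq_1) auto

lemma E0_arg_ge:
  fixes Q :: "'x::finite pmf" and W :: "('x, 'y::finite) channel"
  assumes "0 \<le> s" "s \<le> \<rho>" "\<rho> \<le> 1"
  shows "1 / real CARD('y) \<le>
     (\<Sum>y\<in>UNIV. (\<Sum>x\<in>UNIV. pmf Q x * rpow (pmf (W x) y) (1 - s)) *
                rpow (\<Sum>x'\<in>UNIV. pmf Q x' * rpow (pmf (W x') y) (s / \<rho>)) \<rho>)"
proof -
  define q where "q = (\<lambda>y. \<Sum>x\<in>UNIV. pmf Q x * pmf (W x) y)"
  have q0: "0 \<le> q y" for y unfolding q_def by (intro sum_nonneg) auto
  have q_sum: "(\<Sum>y\<in>UNIV. q y) = 1"
  proof -
    have "(\<Sum>y\<in>UNIV. q y) = (\<Sum>x\<in>UNIV. pmf Q x * (\<Sum>y\<in>UNIV. pmf (W x) y))"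
      unfolding q_def sum_distrib_left by (rule sum.swap)
    then show ?thesis by (simp add: sum_pmf_UNIV)
  qed
  have q1: "q y \<le> 1" for y
    using member_le_sum[of y UNIV q] q0 q_sum by simp
  have ge: "q y \<le> (\<Sum>x\<in>UNIV. pmf Q x * rpow (pmf (W x) y) a)" if "0 \<le> a" "a \<le> 1" for y a
    unfolding q_def by (intro sum_mono mult_left_mono rpow_ge) (use that in \<open>auto simp: pmf_le_1\<close>)
  have quot: "0 \<le> s / \<rho>" "s / \<rho> \<le> 1"
    using assms by (auto simp: divide_le_eq_1)
  have "(\<Sum>y\<in>UNIV. 1 * q y)\<^sup>2 \<le> (\<Sum>y\<in>(UNIV :: 'y set). 1\<^sup>2) * (\<Sum>y\<in>UNIV. (q y)\<^sup>2)"
    by (rule Cauchy_Schwarz_ineq_sum)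
  then have "1 / real CARD('y) \<le> (\<Sum>y\<in>UNIV. (q y)\<^sup>2)"
    by (simp add: q_sum divide_le_eq mult.commute)
  also have "\<dots> \<le> (\<Sum>y\<in>UNIV. (\<Sum>x\<in>UNIV. pmf Q x * rpow (pmf (W x) y) (1 - s)) *
                rpow (\<Sum>x'\<in>UNIV. pmf Q x' * rpow (pmf (W x') y) (s / \<rho>)) \<rho>)"
  proof (rule sum_mono)
    fix y
    have "q y \<le> rpow (q y) \<rho>"
      using q0 q1 assms by (intro rpow_ge) auto
    also have "\<dots> \<le> rpow (\<Sum>x'\<in>UNIV. pmf Q x' * rpow (pmf (W x') y) (s / \<rho>)) \<rho>"
      using q0 ge quot assms by (intro rpow_mono) auto
    finally have r: "q y \<le> \<dots>" .
    show "(q y)\<^sup>2 \<le> (\<Sum>x\<in>UNIV. pmf Q x * rpow (pmf (W x) y) (1 - s)) *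
                rpow (\<Sum>x'\<in>UNIV. pmf Q x' * rpow (pmf (W x') y) (s / \<rho>)) \<rho>"
      unfolding power2_eq_square
      using q0 r ge[of "1 - s" y] assms by (intro mult_mono)
        (auto intro!: sum_nonneg mult_nonneg_nonneg rpow_nonneg)
  qed
  finally show ?thesis .
qed

lemma E0_le:
  fixes Q :: "'x::finite pmf" and W :: "('x, 'y::finite) channel"
  assumes "0 \<le> s" "s \<le> \<rho>" "\<rho> \<le> 1"
  shows "E0 s \<rho> Q W \<le> ln (real CARD('y))"
proof -
  have pos: "0 < 1 / real CARD('y)" by simp
  have "ln (1 / real CARD('y)) \<le>
     ln (\<Sum>y\<in>UNIV. (\<Sum>x\<in>UNIV. pmf Q x * rpow (pmf (W x) y) (1 - s)) *
                rpow (\<Sum>x'\<in>UNIV. pmf Q x' * rpow (pmf (W x') y) (s / \<rho>)) \<rho>)"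
    using E0_arg_ge[OF assms, of Q W] pos by (intro ln_mono) linarith+
  then show ?thesis unfolding E0_def by (simp add: ln_div)
qed

lemma exponent_le:
  fixes Q :: "'x::finite pmf" and W :: "('x, 'y::finite) channel"
  assumes "0 \<le> s" "s \<le> \<rho>" "\<rho> \<le> 1" "0 \<le> R" "0 \<le> T"
  shows "E0 s \<rho> Q W - \<rho> * R - s * T \<le> ln (real CARD('y))"
proof -
  have "0 \<le> \<rho> * R" "0 \<le> s * T" using assms by auto
  then show ?thesis using E0_le[OF assms(1-3), of Q W] by linarith
qed

lemma bdd_above_exponent:
  fixes W :: "('x::finite, 'y::finite) channel"
  assumes "0 \<le> s" "s \<le> \<rho>" "\<rho> \<le> 1" "0 \<le> R" "0 \<le> T"
  shows "bdd_above (range (\<lambda>Q. E0 s \<rho> Q W - \<rho> * R - s * T))"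
  using exponent_le[OF assms] by (intro bdd_aboveI2)

lemma SUP_exponent_le:
  fixes W :: "('x::finite, 'y::finite) channel"
  assumes "0 \<le> s" "s \<le> \<rho>" "\<rho> \<le> 1" "0 \<le> R" "0 \<le> T"
  shows "(SUP Q\<in>UNIV. E0 s \<rho> Q W - \<rho> * R - s * T) \<le> ln (real CARD('y))"
  by (rule cSUP_least) (use exponent_le[OF assms] in auto)

lemma bdd_above_E1:
  fixes W :: "('x::finite, 'y::finite) channel"
  assumes "0 \<le> R" "0 \<le> T"
  shows "bdd_above ((\<lambda>(s, \<rho>). SUP Q\<in>UNIV. E0 s \<rho> Q W - \<rho> * R - s * T) `
           {(s, \<rho>). 0 \<le> s \<and> s \<le> \<rho> \<and> \<rho> \<le> 1})"
  by (rule bdd_aboveI2[where M = "ln (real CARD('y))"])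
     (use SUP_exponent_le assms in auto)

lemma E1_le:
  fixes W :: "('x::finite, 'y::finite) channel"
  assumes "0 \<le> R" "0 \<le> T"
  shows "E1 R T W \<le> ln (real CARD('y))"
  unfolding E1_def
proof (rule cSUP_least)
  show "{(s, \<rho>). 0 \<le> s \<and> s \<le> \<rho> \<and> \<rho> \<le> (1::real)} \<noteq> {}"
    by (auto intro!: exI[of _ 0])
qed (use SUP_exponent_le assms in auto)

lemma E0_0_0: "E0 0 0 Q W = 0"
proof -
  have "(\<Sum>y\<in>UNIV. \<Sum>x\<in>UNIV. pmf Q x * pmf (W x) y) =
        (\<Sum>x\<in>UNIV. pmf Q x * (\<Sum>y\<in>UNIV. pmf (W x) y))"
    unfolding sum_distrib_left by (rule sum.swap)
  then show ?thesis by (simp add: E0_def rpow_def sum_pmf_UNIV)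
qed

lemma E1_nonneg:
  assumes "0 \<le> R" "0 \<le> T"
  shows "0 \<le> E1 R T W"
proof -
  have "(case (0, 0) of (s, \<rho>) \<Rightarrow> SUP Q\<in>UNIV. E0 s \<rho> Q W - \<rho> * R - s * T) \<le> E1 R T W"
    unfolding E1_def by (rule cSUP_upper[OF _ bdd_above_E1[OF assms]]) auto
  then show ?thesis by (simp add: E0_0_0)
qed

lemma exp_weight_le:
  fixes W :: "('x::finite, 'y::finite) channel"
  assumes "0 \<le> R" "0 \<le> T" "0 \<le> \<xi>"
  shows "exp (real n * (\<xi> * E1 R T W + T)) \<le> exp (real n * (\<xi> * ln (real CARD('y)) + T))"
  using E1_le[OF assms(1,2), of W] assms by (auto intro!: mult_left_mono)

lemma bdd_above_metric_f:
  fixes P :: "'t \<Rightarrow> ('x::finite, 'y::finite) channel"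
  assumes "0 \<le> R" "0 \<le> T" "0 \<le> \<xi>"
  shows "bdd_above ((\<lambda>\<theta>. exp (real n * (\<xi> * E1 R T (P \<theta>) + T)) * word_prob (P \<theta>) y x) ` \<Theta>)"
proof (rule bdd_aboveI2)
  fix \<theta>
  show "exp (real n * (\<xi> * E1 R T (P \<theta>) + T)) * word_prob (P \<theta>) y x
        \<le> exp (real n * (\<xi> * ln (real CARD('y)) + T)) * 1"
    by (intro mult_mono exp_weight_le assms word_prob_le_1 word_prob_nonneg) auto
qed

lemma bdd_above_K_dec:
  fixes P :: "'t \<Rightarrow> ('x::finite, 'y::finite) channel"
  assumes "0 \<le> R" "0 \<le> T" "0 \<le> \<xi>"
  shows "bdd_above ((\<lambda>\<theta>. Lagrangian n T M C D (P \<theta>) /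
                          exp (- real n * (\<xi> * E1 R T (P \<theta>) + T))) ` \<Theta>)"
proof (rule bdd_aboveI2)
  fix \<theta>
  define B where "B = 1 / real M * (\<Sum>m=1..M. \<Sum>y\<in>D m. \<Sum>m'\<in>{1..M} - {m}. 1) +
     exp (- real n * T) * (1 / real M * (\<Sum>m=1..M. \<Sum>y\<in>words n - D m. 1))"
  have L: "Lagrangian n T M C D (P \<theta>) \<le> B"
    unfolding Lagrangian_def prob_E1_def prob_E2_def B_def
    by (intro add_mono mult_left_mono sum_mono word_prob_le_1) auto
  have L0: "0 \<le> Lagrangian n T M C D (P \<theta>)"
    unfolding Lagrangian_def prob_E1_def prob_E2_def
    by (intro add_nonneg_nonneg mult_nonneg_nonneg sum_nonneg word_prob_nonneg) auto
  have "Lagrangian n T M C D (P \<theta>) / exp (- real n * (\<xi> * E1 R T (P \<theta>) + T))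
        = Lagrangian n T M C D (P \<theta>) * exp (real n * (\<xi> * E1 R T (P \<theta>) + T))"
    by (simp add: exp_minus divide_inverse)
  also have "\<dots> \<le> B * exp (real n * (\<xi> * ln (real CARD('y)) + T))"
    using L L0 by (intro mult_mono exp_weight_le assms) auto
  finally show "Lagrangian n T M C D (P \<theta>) / exp (- real n * (\<xi> * E1 R T (P \<theta>) + T))
        \<le> B * exp (real n * (\<xi> * ln (real CARD('y)) + T))" .
qed

end

theory Submission imports Defs begin

text \<open>
  Both \<open>K_dec\<close> and the objective obtained from it by replacing every weighted likelihood
  by its supremum \<open>f\<close> over \<open>\<theta>\<close> are sums over pairs (codeword, output word). The universal
  decoder minimises the second objective term by term. Weighted likelihoods depend on the pair only
  through its joint type, so a sum of suprema has at most \<open>(n + 1)^(|X||Y| - 1)\<close>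
  distinct suprema, each of which is bounded by the supremum of the whole sum.
\<close>

section \<open>Joint types: their number, and likelihoods as functions of them\<close>

text \<open>A multiset of size \<open>n\<close> is the type of a word of length \<open>n\<close>.
  Dropping the multiplicity of one letter loses no information, and each remaining multiplicity
  takes at most \<open>n + 1\<close> values; this is where the \<open>- 1\<close> in the exponent
  comes from.\<close>

lemma finite_card_multisets_of_size_le:
  "finite {X :: 'a::finite multiset. size X = n} \<and>
   card {X :: 'a multiset. size X = n} \<le> (n + 1) ^ (CARD('a) - 1)"
proof -
  fix z :: 'a
  \<comment> \<open>The multiplicity of \<open>z\<close> is determined by the others and the size.\<close>
  let ?A = "UNIV - {z}" and ?S = "{X :: 'a multiset. size X = n}"
  let ?r = "\<lambda>X :: 'a multiset. restrict (count X) ?A"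
  have size: "size X = count X z + (\<Sum>a\<in>?A. count X a)" for X :: "'a multiset"
  proof -
    have "size X = (\<Sum>a\<in>UNIV. count X a)"
      unfolding size_multiset_overloaded_eq
      by (intro sum.mono_neutral_left) (auto simp: count_eq_zero_iff)
    then show ?thesis by (simp add: sum.remove)
  qed
  have "inj_on ?r ?S"
  proof (rule inj_onI)
    fix X Y assume XY: "X \<in> ?S" "Y \<in> ?S" "?r X = ?r Y"
    have eq: "count X a = count Y a" if "a \<noteq> z" for a
      using fun_cong[OF XY(3), of a] that by simp
    then have "(\<Sum>a\<in>?A. count X a) = (\<Sum>a\<in>?A. count Y a)" by (intro sum.cong) auto
    then have "count X z = count Y z" using size[of X] size[of Y] XY by simp
    then show "X = Y" using eq by (metis multiset_eqI)
  qed
  moreover have "?r ` ?S \<subseteq> ?A \<rightarrow>\<^sub>E {0..n}"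
    by (intro image_subsetI restrict_PiE_iff[THEN iffD2]) (auto simp: count_le_size)
  moreover have "finite (?A \<rightarrow>\<^sub>E {0..n})" by (simp add: finite_PiE)
  ultimately have "finite ?S \<and> card ?S \<le> card (?A \<rightarrow>\<^sub>E {0..n})"
    by (metis inj_on_finite card_inj_on_le)
  then show ?thesis by (simp add: card_PiE card_Diff_singleton)
qed

text \<open>The channel is memoryless, so the order of the factors is irrelevant and only the joint
  type \<open>mset (zip xs ys)\<close> matters.\<close>

lemma word_prob_eq_prod_mset:
  assumes "length ys = length xs"
  shows "word_prob W ys xs = (\<Prod>(a, b)\<in>#mset (zip xs ys). pmf (W a) b)"
proof -
  have "(\<Prod>(a, b)\<in>#mset (zip xs ys). pmf (W a) b) = (\<Prod>(a, b)\<leftarrow>zip xs ys. pmf (W a) b)"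
    by (simp flip: prod_mset_prod_list)
  also have "\<dots> = word_prob W ys xs"
    using assms by (simp add: word_prob_def prod.list_conv_set_nth atLeast0LessThan)
  finally show ?thesis by simp
qed

section \<open>Exchanging sum and supremum at the cost of the number of types\<close>

text \<open>Group the terms by the value of \<open>\<kappa>\<close>. All terms of one class share
  the same supremum, so a class contributes its total weight times one supremum. Partial sums never
  exceed the whole sum, since all terms are nonnegative; hence each class stays below
  \<open>?K\<close>.\<close>

lemma sum_SUP_le_card_SUP_sum:
  fixes \<phi> :: "'t \<Rightarrow> 'k \<Rightarrow> real"
  assumes "finite A" "\<Theta> \<noteq> {}"
    and c: "\<And>a. a \<in> A \<Longrightarrow> 0 \<le> c a"
    and \<phi>: "\<And>\<theta> k. \<theta> \<in> \<Theta> \<Longrightarrow> 0 \<le> \<phi> \<theta> k"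
    and bdd: "bdd_above ((\<lambda>\<theta>. \<Sum>a\<in>A. c a * \<phi> \<theta> (\<kappa> a)) ` \<Theta>)"
  shows "(\<Sum>a\<in>A. c a * (SUP \<theta>\<in>\<Theta>. \<phi> \<theta> (\<kappa> a)))
         \<le> real (card (\<kappa> ` A)) * (SUP \<theta>\<in>\<Theta>. \<Sum>a\<in>A. c a * \<phi> \<theta> (\<kappa> a))"
    (is "_ \<le> _ * ?K")
proof -
  have K0: "0 \<le> ?K"
  proof -
    obtain \<theta> where "\<theta> \<in> \<Theta>" using assms by blast
    then show ?thesis
      by (intro cSUP_upper2[OF bdd, of \<theta>] sum_nonneg mult_nonneg_nonneg c \<phi>)
  qed
  have *: "(\<Sum>a | a \<in> A \<and> \<kappa> a = k. c a * (SUP \<theta>\<in>\<Theta>. \<phi> \<theta> (\<kappa> a))) \<le> ?K" for k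
  proof -
    define w where "w = (\<Sum>a | a \<in> A \<and> \<kappa> a = k. c a)"
    have "w \<ge> 0" unfolding w_def using c by (intro sum_nonneg) auto
    have le: "w * \<phi> \<theta> k \<le> ?K" if "\<theta> \<in> \<Theta>" for \<theta>
    proof -
      have "w * \<phi> \<theta> k = (\<Sum>a | a \<in> A \<and> \<kappa> a = k. c a * \<phi> \<theta> (\<kappa> a))"
        unfolding w_def sum_distrib_right by (intro sum.cong) auto
      also have "\<dots> \<le> (\<Sum>a\<in>A. c a * \<phi> \<theta> (\<kappa> a))"
        using assms that by (intro sum_mono2) auto
      also have "\<dots> \<le> ?K" by (rule cSUP_upper[OF that bdd])
      finally show ?thesis .
    qed
    have "w * (SUP \<theta>\<in>\<Theta>. \<phi> \<theta> k) \<le> ?K"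
    \<comment> \<open>Only the weighted sum is assumed bounded. If \<open>w = 0\<close>, the values
      \<open>\<phi> \<theta> k\<close> may be unbounded and their \<open>SUP\<close> unspecified,
      but it is multiplied by 0. If \<open>w > 0\<close>, then \<open>?K / w\<close> bounds
      them.\<close>
    proof (cases "w = 0")
      case False
      with \<open>w \<ge> 0\<close> have "w > 0" by simp
      then have "(SUP \<theta>\<in>\<Theta>. \<phi> \<theta> k) \<le> ?K / w"
        using le assms(2) by (intro cSUP_least) (auto simp: field_simps)
      then show ?thesis using \<open>w > 0\<close> by (simp add: field_simps)
    qed (simp add: K0)
    moreover have "(\<Sum>a | a \<in> A \<and> \<kappa> a = k. c a * (SUP \<theta>\<in>\<Theta>. \<phi> \<theta> (\<kappa> a)))
        = w * (SUP \<theta>\<in>\<Theta>. \<phi> \<theta> k)"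
      unfolding w_def sum_distrib_right by (intro sum.cong) auto
    ultimately show ?thesis by simp
  qed
  have "(\<Sum>a\<in>A. c a * (SUP \<theta>\<in>\<Theta>. \<phi> \<theta> (\<kappa> a)))
      = (\<Sum>k\<in>\<kappa> ` A. \<Sum>a | a \<in> A \<and> \<kappa> a = k. c a * (SUP \<theta>\<in>\<Theta>. \<phi> \<theta> (\<kappa> a)))"
    by (rule sum.image_gen) fact
  also have "\<dots> \<le> (\<Sum>k\<in>\<kappa> ` A. ?K)" by (intro sum_mono *)
  finally show ?thesis by simp
qed

section \<open>The cost functional and its minimisation\<close>

text \<open>The Lagrangian of a decoder as a functional of the likelihoods \<open>g m y\<close>.\<close>

definition cost ::
  "nat \<Rightarrow> real \<Rightarrow> nat \<Rightarrow> (nat \<Rightarrow> 'y list set) \<Rightarrow> (nat \<Rightarrow> 'y list \<Rightarrow> real) \<Rightarrow> real" where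
  "cost n T M D g = 1 / real M * (\<Sum>m=1..M. \<Sum>y\<in>words n.
     if y \<in> D m then \<Sum>m'\<in>{1..M} - {m}. g m' y else exp (- real n * T) * g m y)"

text \<open>The total weight of \<open>g m y\<close> in the cost: one unit for every wrong region
  containing \<open>y\<close>, counted with multiplicity if regions overlap, and the erasure penalty
  if \<open>y\<close> misses its own region.\<close>

definition cost_coeff :: "nat \<Rightarrow> real \<Rightarrow> nat \<Rightarrow> (nat \<Rightarrow> 'y list set) \<Rightarrow> nat \<times> 'y list \<Rightarrow> real" where
  "cost_coeff n T M D = (\<lambda>(m, y). 1 / real M *
     ((\<Sum>m'\<in>{1..M} - {m}. of_bool (y \<in> D m')) + of_bool (y \<notin> D m) * exp (- real n * T)))"

lemma cost_coeff_nonneg: "0 \<le> cost_coeff n T M D a"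
  by (auto simp: cost_coeff_def split_beta intro!: mult_nonneg_nonneg add_nonneg_nonneg sum_nonneg)

text \<open>Renaming the pair \<open>(m, m')\<close> in the undetected-error sum collects all
  occurrences of each likelihood. The result is linear with nonnegative coefficients, the form
  required by \<open>sum_SUP_le_card_SUP_sum\<close>.\<close>

lemma cost_eq_sum:
  fixes D :: "nat \<Rightarrow> 'y::finite list set"
  shows "cost n T M D g = (\<Sum>(m, y)\<in>{1..M} \<times> words n. cost_coeff n T M D (m, y) * g m y)"
proof -
  let ?I = "{1..M}" and ?b = "\<lambda>m y. of_bool (y \<in> D m) :: real"
  have swap: "(\<Sum>m\<in>?I. \<Sum>m'\<in>?I - {m}. ?b m y * g m' y)
      = (\<Sum>m\<in>?I. \<Sum>m'\<in>?I - {m}. ?b m' y * g m y)" for y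
  proof -
    have "(\<Sum>m\<in>?I. \<Sum>m'\<in>?I - {m}. ?b m y * g m' y)
        = (\<Sum>m\<in>?I. \<Sum>m'\<in>{m'\<in>?I. m' \<noteq> m}. ?b m y * g m' y)"
      by (intro sum.cong) auto
    also have "\<dots> = (\<Sum>m'\<in>?I. \<Sum>m\<in>{m\<in>?I. m' \<noteq> m}. ?b m y * g m' y)"
      by (rule sum.swap_restrict) auto
    also have "\<dots> = (\<Sum>m\<in>?I. \<Sum>m'\<in>?I - {m}. ?b m' y * g m y)"
      by (intro sum.cong) auto
    finally show ?thesis .
  qed
  have "cost n T M D g = 1 / real M * (\<Sum>m\<in>?I. \<Sum>y\<in>words n.
      (\<Sum>m'\<in>?I - {m}. ?b m y * g m' y) + of_bool (y \<notin> D m) * exp (- real n * T) * g m y)"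
    unfolding cost_def by (intro arg_cong2[where f = "(*)"] sum.cong refl) auto
  also have "\<dots> = 1 / real M * (\<Sum>y\<in>words n.
      (\<Sum>m\<in>?I. \<Sum>m'\<in>?I - {m}. ?b m y * g m' y)
      + (\<Sum>m\<in>?I. of_bool (y \<notin> D m) * exp (- real n * T) * g m y))"
    by (subst sum.swap) (simp add: sum.distrib)
  also have "\<dots> = (\<Sum>y\<in>words n. \<Sum>m\<in>?I. cost_coeff n T M D (m, y) * g m y)"
    unfolding swap sum_distrib_left cost_coeff_def
    by (simp add: sum_distrib_left sum_distrib_right sum.distrib algebra_simps)
  also have "\<dots> = (\<Sum>m\<in>?I. \<Sum>y\<in>words n. cost_coeff n T M D (m, y) * g m y)"
    by (rule sum.swap)
  finally show ?thesis by (simp add: sum.cartesian_product)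
qed

lemma cost_mono:
  assumes "\<And>m y. m \<in> {1..M} \<Longrightarrow> y \<in> words n \<Longrightarrow> g m y \<le> h m y"
  shows "cost n T M D g \<le> cost n T M D h"
  unfolding cost_def using assms by (intro mult_left_mono sum_mono) (auto intro!: sum_mono)

lemma cost_scale: "cost n T M D (\<lambda>m y. c * g m y) = c * cost n T M D g"
  unfolding cost_def sum_distrib_left
  by (intro sum.cong) (auto simp: sum_distrib_left mult_ac)

text \<open>For each message, \<open>words n\<close> splits into \<open>D m\<close> and its
  complement. Messages are treated separately, so overlapping regions are covered, as ties in
  \<open>univ_decoder\<close> demand.\<close>

lemma Lagrangian_eq_cost:
  fixes D :: "nat \<Rightarrow> 'y::finite list set"
  assumes "\<forall>m\<in>{1..M}. D m \<subseteq> words n"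
  shows "Lagrangian n T M C D W = cost n T M D (\<lambda>m y. word_prob W y (C m))"
proof -
  have "(\<Sum>y\<in>words n. if y \<in> D m then a y else b y)
      = (\<Sum>y\<in>D m. a y) + (\<Sum>y\<in>words n - D m. b y)"
    if "m \<in> {1..M}" for m and a b :: "'y list \<Rightarrow> real"
  proof -
    have "words n \<inter> {y. y \<in> D m} = D m" "words n \<inter> - {y. y \<in> D m} = words n - D m"
      using assms that by auto
    then show ?thesis by (simp add: sum.If_cases finite_words)
  qed
  then show ?thesis
    unfolding Lagrangian_def prob_E1_def prob_E2_def cost_def
    by (simp add: sum.distrib sum_distrib_left distrib_left mult_ac)
qed

text \<open>The summand at \<open>(m, y)\<close> depends on the decoder only through whether
  \<open>y\<close> lies in region \<open>m\<close>. The test defining \<open>univ_region\<close>,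
  multiplied by \<open>exp (- real n * T)\<close>, picks the smaller of the two possible
  values.\<close>

lemma cost_univ_decoder_le:
  fixes P :: "'t \<Rightarrow> ('x::finite, 'y::finite) channel"
  shows "cost n T M (univ_decoder n R T \<xi> M \<Theta> P C) (\<lambda>m. metric_f n R T \<xi> \<Theta> P (C m))
   \<le> cost n T M D (\<lambda>m. metric_f n R T \<xi> \<Theta> P (C m))"
  unfolding cost_def
proof (intro mult_left_mono sum_mono)
  fix m and y :: "'y list" assume "m \<in> {1..M}" and y: "y \<in> words n"
  let ?f = "\<lambda>m. metric_f n R T \<xi> \<Theta> P (C m) y"
  have "y \<in> univ_decoder n R T \<xi> M \<Theta> P C m
      \<longleftrightarrow> (\<Sum>m'\<in>{1..M} - {m}. ?f m') \<le> exp (- real n * T) * ?f m"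
    using \<open>m \<in> {1..M}\<close> y
    by (simp add: univ_decoder_def univ_region_def exp_minus field_simps)
  then show "(if y \<in> univ_decoder n R T \<xi> M \<Theta> P C m then \<Sum>m'\<in>{1..M} - {m}. ?f m'
         else exp (- real n * T) * ?f m)
       \<le> (if y \<in> D m then \<Sum>m'\<in>{1..M} - {m}. ?f m' else exp (- real n * T) * ?f m)"
    by auto
qed simp

section \<open>Comparing \<open>K_dec\<close> with the cost at the metric \<open>f\<close>\<close>

lemma K_dec_eq_SUP_cost:
  fixes P :: "'t \<Rightarrow> ('x::finite, 'y::finite) channel"
  assumes "\<forall>m\<in>{1..M}. D m \<subseteq> words n"
  shows "K_dec n R T \<xi> M \<Theta> P C D =
    (SUP \<theta>\<in>\<Theta>. cost n T M D
       (\<lambda>m y. exp (real n * (\<xi> * E1 R T (P \<theta>) + T)) * word_prob (P \<theta>) y (C m)))"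
  unfolding K_dec_def cost_scale Lagrangian_eq_cost[OF assms]
  by (simp add: exp_minus divide_inverse mult.commute)

text \<open>The cost is monotone in the likelihoods, and \<open>f\<close> dominates every weighted
  likelihood pointwise.\<close>

lemma K_dec_le_cost_metric_f:
  fixes P :: "'t \<Rightarrow> ('x::finite, 'y::finite) channel"
  assumes "\<Theta> \<noteq> {}" "0 \<le> R" "0 \<le> T" "0 \<le> \<xi>"
    and "\<forall>m\<in>{1..M}. D m \<subseteq> words n"
  shows "K_dec n R T \<xi> M \<Theta> P C D \<le> cost n T M D (\<lambda>m. metric_f n R T \<xi> \<Theta> P (C m))"
  unfolding K_dec_eq_SUP_cost[OF assms(5)] metric_f_def
  by (intro cSUP_least cost_mono cSUP_upper bdd_above_metric_f assms)

text \<open>The reverse comparison, which loses only the number of joint types as a factor.\<close>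

lemma cost_metric_f_le_K_dec:
  fixes P :: "'t \<Rightarrow> ('x::finite, 'y::finite) channel"
  assumes "\<Theta> \<noteq> {}" "0 \<le> R" "0 \<le> T" "0 \<le> \<xi>"
    and C: "is_code n M C"
    and D: "\<forall>m\<in>{1..M}. D m \<subseteq> words n"
  shows "cost n T M D (\<lambda>m. metric_f n R T \<xi> \<Theta> P (C m))
         \<le> (real n + 1) ^ (CARD('x) * CARD('y) - 1) * K_dec n R T \<xi> M \<Theta> P C D"
proof -
  define A :: "(nat \<times> 'y list) set" where "A = {1..M} \<times> words n"
  define c where "c = cost_coeff n T M D"
  \<comment> \<open>\<open>\<kappa>\<close> is the joint type of codeword and output, and
    \<open>\<phi> \<theta> k\<close> the weighted likelihood shared by all pairs of type
    \<open>k\<close>.\<close>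
  define \<kappa> where "\<kappa> = (\<lambda>(m, y :: 'y list). mset (zip (C m) y))"
  define \<phi> where "\<phi> = (\<lambda>\<theta> k. exp (real n * (\<xi> * E1 R T (P \<theta>) + T)) *
    (\<Prod>(a, b)\<in>#k. pmf (P \<theta> a) b))"
  have len: "length (C m) = n" "length y = n" if "(m, y) \<in> A" for m y
    using that C by (auto simp: A_def is_code_def words_def)
  have \<phi>_\<kappa>: "exp (real n * (\<xi> * E1 R T (P \<theta>) + T)) * word_prob (P \<theta>) y (C m) = \<phi> \<theta> (\<kappa> (m, y))"
    if "(m, y) \<in> A" for \<theta> m y
    using len[OF that] by (simp add: \<phi>_def \<kappa>_def word_prob_eq_prod_mset)
  have cost_\<theta>: "cost n T M D
      (\<lambda>m y. exp (real n * (\<xi> * E1 R T (P \<theta>) + T)) * word_prob (P \<theta>) y (C m))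
      = (\<Sum>a\<in>A. c a * \<phi> \<theta> (\<kappa> a))" for \<theta>
    unfolding cost_eq_sum c_def A_def[symmetric] by (intro sum.cong) (auto simp: \<phi>_\<kappa>)
  have cost_f: "cost n T M D (\<lambda>m. metric_f n R T \<xi> \<Theta> P (C m))
      = (\<Sum>a\<in>A. c a * (SUP \<theta>\<in>\<Theta>. \<phi> \<theta> (\<kappa> a)))"
    unfolding cost_eq_sum c_def A_def[symmetric] metric_f_def
    by (intro sum.cong) (auto simp: \<phi>_\<kappa>)
  have K: "K_dec n R T \<xi> M \<Theta> P C D = (SUP \<theta>\<in>\<Theta>. \<Sum>a\<in>A. c a * \<phi> \<theta> (\<kappa> a))"
    by (simp add: K_dec_eq_SUP_cost[OF D] cost_\<theta>)
  \<comment> \<open>The cost at \<open>f\<close> is a common upper bound for all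
    \<open>\<theta>\<close>.\<close>
  have "bdd_above ((\<lambda>\<theta>. cost n T M D
      (\<lambda>m y. exp (real n * (\<xi> * E1 R T (P \<theta>) + T)) * word_prob (P \<theta>) y (C m))) ` \<Theta>)"
    by (rule bdd_aboveI2, rule cost_mono, rule cSUP_upper, assumption,
        rule bdd_above_metric_f[OF assms(2-4)])
  then have bdd: "bdd_above ((\<lambda>\<theta>. \<Sum>a\<in>A. c a * \<phi> \<theta> (\<kappa> a)) ` \<Theta>)"
    by (simp add: cost_\<theta>)
  have fin: "finite A" by (simp add: A_def finite_words)
  have c0: "0 \<le> c a" for a by (simp add: c_def cost_coeff_nonneg)
  have \<phi>0: "0 \<le> \<phi> \<theta> k" for \<theta> k
    by (induction k) (auto simp: \<phi>_def zero_le_mult_iff)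
  have "\<kappa> ` A \<subseteq> {X :: ('x \<times> 'y) multiset. size X = n}"
    using len by (auto simp: \<kappa>_def)
  moreover have "finite {X :: ('x \<times> 'y) multiset. size X = n}"
    using finite_card_multisets_of_size_le by blast
  ultimately have "card (\<kappa> ` A) \<le> card {X :: ('x \<times> 'y) multiset. size X = n}"
    by (intro card_mono)
  also have "\<dots> \<le> (n + 1) ^ (CARD('x) * CARD('y) - 1)"
    using finite_card_multisets_of_size_le[where 'a = "'x \<times> 'y" and n = n] by simp
  finally have "real (card (\<kappa> ` A)) \<le> real ((n + 1) ^ (CARD('x) * CARD('y) - 1))"
    by (rule of_nat_mono)
  then have card: "real (card (\<kappa> ` A)) \<le> (real n + 1) ^ (CARD('x) * CARD('y) - 1)"
    by (simp add: add.commute)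
  \<comment> \<open>Nonnegativity of \<open>K_dec\<close> allows the bound on the number of types to
    be multiplied by it.\<close>
  obtain \<theta> where "\<theta> \<in> \<Theta>" using assms by blast
  then have "0 \<le> K_dec n R T \<xi> M \<Theta> P C D"
    unfolding K
    by (intro cSUP_upper2[OF bdd, of \<theta>] sum_nonneg mult_nonneg_nonneg c0 \<phi>0)
  moreover have "cost n T M D (\<lambda>m. metric_f n R T \<xi> \<Theta> P (C m))
      \<le> real (card (\<kappa> ` A)) * K_dec n R T \<xi> M \<Theta> P C D"
    unfolding cost_f K
    using fin assms(1) c0 \<phi>0 bdd
    by (intro sum_SUP_le_card_SUP_sum[where A = A and c = c and \<phi> = \<phi> and \<kappa> = \<kappa>])
  ultimately show ?thesis using mult_right_mono[OF card] by (meson order_trans)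
qed

theorem theorem1:
  fixes P :: "'t \<Rightarrow> 'x::finite \<Rightarrow> 'y::finite pmf"
    and \<Theta> :: "'t set"
    and R T \<xi> :: real
    and n M :: nat
    and C :: "nat \<Rightarrow> 'x list"
  assumes "\<Theta> \<noteq> {}"
    and "R \<ge> 0" and "T \<ge> 0"
    and "0 < \<xi>" and "\<xi> \<le> 1"
    and "n \<ge> 1"
    and "real M = exp (real n * R)"
    and "is_code n M C"
  shows "K_dec n R T \<xi> M \<Theta> P C (univ_decoder n R T \<xi> M \<Theta> P C)
         \<le> (real n + 1) ^ (CARD('x) * CARD('y) - 1) * K_code n R T \<xi> M \<Theta> P C"
proof -
  let ?U = "univ_decoder n R T \<xi> M \<Theta> P C"
  let ?F = "\<lambda>D. cost n T M D (\<lambda>m. metric_f n R T \<xi> \<Theta> P (C m))"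
  \<comment> \<open>The minimum over the finite nonempty set of decoders is attained, so it suffices
    to compare with one optimal \<open>D\<close>.\<close>
  have "K_code n R T \<xi> M \<Theta> P C \<in> K_dec n R T \<xi> M \<Theta> P C ` decoders n M"
    unfolding K_code_def by (rule Min_in) (simp_all add: finite_decoders decoders_nonempty)
  then obtain D where D: "D \<in> decoders n M" "K_code n R T \<xi> M \<Theta> P C = K_dec n R T \<xi> M \<Theta> P C D"
    by blast
  \<comment> \<open>Ties may keep \<open>?U\<close> out of \<open>decoders n M\<close>; what this
    bound asks is that its regions lie in \<open>words n\<close>.\<close>
  have "K_dec n R T \<xi> M \<Theta> P C ?U \<le> ?F ?U"
    using assms by (intro K_dec_le_cost_metric_f) (auto simp: univ_decoder_def univ_region_def)
  also have "\<dots> \<le> ?F D" by (rule cost_univ_decoder_le)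
  also have "\<dots> \<le> (real n + 1) ^ (CARD('x) * CARD('y) - 1) * K_dec n R T \<xi> M \<Theta> P C D"
    using assms D(1) by (intro cost_metric_f_le_K_dec) (auto simp: decoders_def PiE_iff)
  finally show ?thesis by (simp add: D(2))
qed

end
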